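(* Let $p\ge 5$ be a prime and let $n\ge 2$. The group $$G:=\langle x,y\mid x^{p^n},\ y^{p^n},\ x^y=x^{p+1}\rangle$$ is a non-abelian Beauville group of order $p^{2n}$.
   Context: Let $G$ be a finite group with identity $e$. For $x,y\in G$ put $$\Sigma(x,y):=\bigcup_{i=1}^{|G|}\bigcup_{g\in G}\{(x^i)^g,(y^i)^g,((xy)^i)^g\},$$ where $a^g$ denotes the conjugate $g^{-1}ag$. A Beauville structure for $G$ is a pair of generating sets $\{x_1,y_1\},\{x_2,y_2\}$ of $G$ (i.e. $\langle x_1,y_1\rangle=\langle x_2,y_2\rangle=G$) such that $\Sigma(x_1,y_1)\cap\Sigma(x_2,y_2)=\{e\}$. $G$ is a Beauville group if there exists a Beauville structure for $G$. *)

theory Defs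
  imports "HOL-Algebra.Generated_Groups" "HOL-Computational_Algebra.Primes"
begin

text \<open>The letter \<open>(a, True)\<close> stands for the generator \<open>a\<close>, and \<open>(a, False)\<close> for its formal
  inverse. The free group on the type \<open>'a\<close> consists of the reduced words.\<close>

type_synonym 'a letter = "'a \<times> bool"

fun inv_letter :: "'a letter \<Rightarrow> 'a letter" where
  "inv_letter (a, b) = (a, \<not> b)"

definition reduced :: "'a letter list \<Rightarrow> bool" where
  "reduced w \<longleftrightarrow> successively (\<lambda>l m. m \<noteq> inv_letter l) w"

fun push :: "'a letter \<Rightarrow> 'a letter list \<Rightarrow> 'a letter list" where
  "push l [] = [l]"
| "push l (m # w) = (if m = inv_letter l then w else l # m # w)"

text \<open>For reduced words \<open>u\<close> and \<open>v\<close>, \<open>foldr push u v\<close> is the reduced form of \<open>u @ v\<close>.\<close>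

definition free_group :: "'a letter list monoid" where
  "free_group = \<lparr>carrier = {w. reduced w}, monoid.mult = (\<lambda>u v. foldr push u v), one = []\<rparr>"

definition free_gen :: "'a \<Rightarrow> 'a letter list" where
  "free_gen a = [(a, True)]"

lemma inv_letter_inv_letter [simp]: "inv_letter (inv_letter l) = l"
  by (cases l) simp

lemma inv_letter_neq [simp]: "inv_letter l \<noteq> l" "l \<noteq> inv_letter l"
  by (cases l; simp)+

lemma reduced_Nil [simp]: "reduced []"
  by (simp add: reduced_def)

lemma reduced_ConsD: "reduced (l # w) \<Longrightarrow> reduced w"
  by (cases w) (auto simp: reduced_def)

lemma reduced_push: "reduced w \<Longrightarrow> reduced (push l w)"
  by (cases w) (auto simp: reduced_def successively_Cons)

lemma reduced_foldr_push: "reduced v \<Longrightarrow> reduced (foldr push u v)"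
  by (induction u) (auto intro: reduced_push)

lemma push_inv_push: "reduced w \<Longrightarrow> push l (push (inv_letter l) w) = w"
  by (cases w; cases "tl w") (auto simp: reduced_def)

lemma push_reduced: "reduced (l # w) \<Longrightarrow> push l w = l # w"
  by (cases w) (auto simp: reduced_def)

lemma foldr_push_push:
  "reduced w \<Longrightarrow> foldr push (push l t) w = push l (foldr push t w)"
  by (cases t) (auto simp: push_inv_push reduced_foldr_push)

lemma foldr_push_assoc:
  "reduced w \<Longrightarrow> foldr push (foldr push u v) w = foldr push u (foldr push v w)"
  by (induction u) (auto simp: foldr_push_push)

lemma foldr_push_Nil: "reduced u \<Longrightarrow> foldr push u [] = u"
proof (induction u)
  case (Cons l u)
  then show ?case
    using reduced_ConsD[of l u] push_reduced[of l u] by simp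
qed simp

lemma foldr_push_left_inverse: "reduced w \<Longrightarrow> foldr push (rev (map inv_letter u)) (foldr push u w) = w"
proof (induction u arbitrary: w)
  case (Cons l u)
  then show ?case
    using push_inv_push[of "foldr push u w" "inv_letter l"] by (simp add: reduced_foldr_push)
qed simp

lemma group_free_group: "group free_group"
proof (rule groupI)
  fix u :: "'a letter list" assume "u \<in> carrier free_group"
  then have u: "reduced u" by (simp add: free_group_def)
  let ?v = "foldr push (rev (map inv_letter u)) []"
  have "foldr push ?v u = foldr push (rev (map inv_letter u)) (foldr push u [])"
    using u by (simp add: foldr_push_assoc foldr_push_Nil)
  then have "foldr push ?v u = []"
    by (simp add: foldr_push_left_inverse)
  then show "\<exists>v\<in>carrier free_group. v \<otimes>\<^bsub>free_group\<^esub> u = \<one>\<^bsub>free_group\<^esub>"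
    by (intro bexI[of _ ?v]) (auto simp: free_group_def reduced_foldr_push)
qed (auto simp: free_group_def reduced_foldr_push foldr_push_assoc)

lemma free_gen_in_carrier [simp]: "free_gen a \<in> carrier free_group"
  by (simp add: free_gen_def free_group_def reduced_def)

definition normal_closure :: "('a, 'b) monoid_scheme \<Rightarrow> 'a set \<Rightarrow> 'a set" where
  "normal_closure G R =
     generate G (\<Union>r\<in>R. \<Union>g\<in>carrier G. {g \<otimes>\<^bsub>G\<^esub> r \<otimes>\<^bsub>G\<^esub> inv\<^bsub>G\<^esub> g})"

text \<open>The group presented by all elements of the type \<open>'a\<close> as generators, subject to the
  relators \<open>R\<close>.\<close>

definition presented_group :: "'a letter list set \<Rightarrow> 'a letter list set monoid" where
  "presented_group R = free_group Mod (normal_closure free_group R)"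

lemma (in group) normal_closure_normal:
  assumes R: "R \<subseteq> carrier G"
  shows "normal_closure G R \<lhd> G"
  unfolding normal_closure_def
proof (rule normal_generateI)
  fix h g
  assume "h \<in> (\<Union>r\<in>R. \<Union>g\<in>carrier G. {g \<otimes> r \<otimes> inv g})" and g: "g \<in> carrier G"
  then obtain r k where r: "r \<in> R" "r \<in> carrier G" and k: "k \<in> carrier G"
    and h: "h = k \<otimes> r \<otimes> inv k"
    using R by blast
  have "g \<otimes> h \<otimes> inv g = (g \<otimes> k) \<otimes> r \<otimes> inv (g \<otimes> k)"
    using g r k by (simp add: h m_assoc inv_mult_group)
  then show "g \<otimes> h \<otimes> inv g \<in> (\<Union>r\<in>R. \<Union>g\<in>carrier G. {g \<otimes> r \<otimes> inv g})"
    using g k r by blast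
qed (use R in auto)

lemma group_presented_group:
  assumes "R \<subseteq> carrier free_group"
  shows "group (presented_group R)"
  unfolding presented_group_def
  by (rule normal.factorgroup_is_group[OF group.normal_closure_normal[OF group_free_group assms]])

definition conj_by :: "('a, 'b) monoid_scheme \<Rightarrow> 'a \<Rightarrow> 'a \<Rightarrow> 'a" where
  "conj_by G a g = inv\<^bsub>G\<^esub> g \<otimes>\<^bsub>G\<^esub> a \<otimes>\<^bsub>G\<^esub> g"

definition Sigma_set :: "('a, 'b) monoid_scheme \<Rightarrow> 'a \<Rightarrow> 'a \<Rightarrow> 'a set" where
  "Sigma_set G x y = (\<Union>i\<in>{1..order G}. \<Union>g\<in>carrier G.
     {conj_by G (x [^]\<^bsub>G\<^esub> i) g,
      conj_by G (y [^]\<^bsub>G\<^esub> i) g,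
      conj_by G ((x \<otimes>\<^bsub>G\<^esub> y) [^]\<^bsub>G\<^esub> i) g})"

definition beauville_structure ::
  "('a, 'b) monoid_scheme \<Rightarrow> 'a \<times> 'a \<Rightarrow> 'a \<times> 'a \<Rightarrow> bool" where
  "beauville_structure G = (\<lambda>(x1, y1) (x2, y2).
     {x1, y1, x2, y2} \<subseteq> carrier G \<and>
     generate G {x1, y1} = carrier G \<and>
     generate G {x2, y2} = carrier G \<and>
     Sigma_set G x1 y1 \<inter> Sigma_set G x2 y2 = {\<one>\<^bsub>G\<^esub>})"

definition beauville_group :: "('a, 'b) monoid_scheme \<Rightarrow> bool" where
  "beauville_group G \<longleftrightarrow>
     group G \<and> finite (carrier G) \<and> (\<exists>s t. beauville_structure G s t)"

datatype generator = Gen_x | Gen_y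

text \<open>A relation \<open>u = v\<close> is encoded as the relator \<open>u \<otimes> inv v\<close>.\<close>

definition metacyclic_relators :: "nat \<Rightarrow> nat \<Rightarrow> generator letter list set" where
  "metacyclic_relators p n =
    (let F = free_group; x = free_gen Gen_x; y = free_gen Gen_y
     in {x [^]\<^bsub>F\<^esub> (p ^ n),
         y [^]\<^bsub>F\<^esub> (p ^ n),
         conj_by F x y \<otimes>\<^bsub>F\<^esub> inv\<^bsub>F\<^esub> (x [^]\<^bsub>F\<^esub> (p + 1))})"

definition metacyclic_group :: "nat \<Rightarrow> nat \<Rightarrow> generator letter list set monoid" where
  "metacyclic_group p n = presented_group (metacyclic_relators p n)"

lemma metacyclic_relators_in_carrier: "metacyclic_relators p n \<subseteq> carrier free_group"
proof -
  interpret group "free_group :: generator letter list monoid"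
    by (rule group_free_group)
  show ?thesis
    by (simp add: metacyclic_relators_def Let_def conj_by_def)
qed

lemma group_metacyclic_group: "group (metacyclic_group p n)"
  unfolding metacyclic_group_def
  by (rule group_presented_group[OF metacyclic_relators_in_carrier])

end

theory Submission
  imports Defs "HOL-Algebra.Multiplicative_Group" "HOL-Number_Theory.Cong"
begin

text \<open>Every element has the form \<open>y^a x^b\<close>, and a semidirect product of two cyclic groups of order
  \<open>p^n\<close> satisfies the relations, so \<open>a\<close> and \<open>b\<close> are unique modulo \<open>p^n\<close>. The power with exponent
  \<open>p^(n-1)\<close> sends \<open>y^a x^b\<close> to the central element \<open>y^(a p^(n-1)) x^(b p^(n-1))\<close>. Hence, if two
  elements \<open>y^a x^b\<close> and \<open>y^c x^d\<close> have \<open>a d - b c\<close> prime to \<open>p\<close>, no conjugates of their powers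
  coincide except at the identity. The generating pairs \<open>{x, y}\<close> and \<open>{y x^2, y x^(p-1)}\<close> together
  with their products give the points \<open>(0:1), (1:0), (1:1)\<close> and \<open>(1:2), (1:-1), (2:1)\<close> of the
  projective line modulo \<open>p\<close>, and all nine determinants between the two triples are
  \<open>\<plusminus>1\<close> or \<open>\<plusminus>2\<close>.\<close>

section \<open>Universal property of presented groups\<close>

text \<open>Words are evaluated letter by letter. Evaluation respects \<open>push\<close> because a
  cancelled pair of letters has values that are inverse to each other.\<close>

lemma free_group_universal:
  assumes H: "group H" and f: "\<And>a. f a \<in> carrier H"
  obtains h where "h \<in> hom free_group H" "\<And>a. h (free_gen a) = f a"
proof -
  interpret H: group H by (rule H)
  define lt where "lt = (\<lambda>(a, b). if b then f a else inv\<^bsub>H\<^esub> (f a))"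
  define h where "h w = foldr (\<lambda>l z. lt l \<otimes>\<^bsub>H\<^esub> z) w \<one>\<^bsub>H\<^esub>" for w
  have lt [simp]: "lt l \<in> carrier H" for l
    using f by (cases l) (auto simp: lt_def)
  have lt_inv: "lt l \<otimes>\<^bsub>H\<^esub> lt (inv_letter l) = \<one>\<^bsub>H\<^esub>" for l
    using f by (cases l) (auto simp: lt_def)
  have h_Nil [simp]: "h [] = \<one>\<^bsub>H\<^esub>" and h_Cons [simp]: "h (l # w) = lt l \<otimes>\<^bsub>H\<^esub> h w" for l w
    by (auto simp: h_def)
  have h_closed [simp]: "h w \<in> carrier H" for w
    by (induction w) auto
  have h_push: "h (push l w) = lt l \<otimes>\<^bsub>H\<^esub> h w" for l w
    by (cases w) (auto simp: H.m_assoc[symmetric] lt_inv)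
  have h_foldr: "h (foldr push u v) = h u \<otimes>\<^bsub>H\<^esub> h v" for u v
    by (induction u) (auto simp: h_push H.m_assoc)
  show ?thesis
  proof
    show "h \<in> hom free_group H"
      by (auto simp: hom_def free_group_def h_foldr)
    show "h (free_gen a) = f a" for a
      using f by (simp add: free_gen_def lt_def)
  qed
qed

lemma generate_free_gen: "generate free_group (range free_gen) = carrier free_group"
proof -
  interpret F: group "free_group :: 'a letter list monoid"
    by (rule group_free_group)
  have "w \<in> generate free_group (range free_gen)" if "reduced w" for w :: "'a letter list"
    using that
  proof (induction w)
    case Nil
    show ?case
      using generate.one[of free_group "range free_gen"] by (simp add: free_group_def)
  next
    case (Cons l w)
    obtain a b where l: "l = (a, b)" by (cases l)
    have inv: "inv\<^bsub>free_group\<^esub> (free_gen a) = [(a, False)]"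
      by (rule F.inv_equality) (auto simp: free_group_def free_gen_def reduced_def)
    have "[l] \<in> generate free_group (range free_gen)"
    proof (cases b)
      case True
      then show ?thesis
        using generate.incl[of "free_gen a" "range free_gen" free_group]
        by (simp add: l free_gen_def)
    next
      case False
      then show ?thesis
        using generate.inv[of "free_gen a" "range free_gen" free_group] inv by (simp add: l)
    qed
    moreover have "w \<in> generate free_group (range free_gen)"
      using Cons reduced_ConsD by blast
    ultimately have "[l] \<otimes>\<^bsub>free_group\<^esub> w \<in> generate free_group (range free_gen)"
      by (rule generate.eng)
    moreover have "[l] \<otimes>\<^bsub>free_group\<^esub> w = l # w"
      using push_reduced[OF Cons.prems] by (simp add: free_group_def)
    ultimately show ?case by simp
  qed
  moreover have "generate free_group (range free_gen) \<subseteq> carrier (free_group :: 'a letter list monoid)"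
    by (rule F.generate_incl) auto
  ultimately show ?thesis
    by (auto simp: free_group_def)
qed

definition presented_class :: "'a letter list set \<Rightarrow> 'a letter list \<Rightarrow> 'a letter list set" where
  "presented_class R w = normal_closure free_group R #>\<^bsub>free_group\<^esub> w"

lemma presented_class_hom:
  assumes "R \<subseteq> carrier free_group"
  shows "group_hom free_group (presented_group R) (presented_class R)"
proof -
  interpret N: normal "normal_closure free_group R" free_group
    by (rule group.normal_closure_normal[OF group_free_group assms])
  show ?thesis
    unfolding group_hom_def group_hom_axioms_def presented_class_def presented_group_def
    using N.r_coset_hom_Mod N.factorgroup_is_group group_free_group by blast
qed

lemma presented_class_relator:
  assumes R: "R \<subseteq> carrier free_group" and r: "r \<in> R"
  shows "presented_class R r = \<one>\<^bsub>presented_group R\<^esub>"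
proof -
  interpret F: group free_group by (rule group_free_group)
  interpret N: normal "normal_closure free_group R" free_group
    by (rule F.normal_closure_normal[OF R])
  have "\<one>\<^bsub>free_group\<^esub> \<otimes>\<^bsub>free_group\<^esub> r \<otimes>\<^bsub>free_group\<^esub> inv\<^bsub>free_group\<^esub> \<one>\<^bsub>free_group\<^esub>
      \<in> normal_closure free_group R"
    unfolding normal_closure_def using r by (intro generate.incl) blast
  then have "r \<in> normal_closure free_group R"
    using R r by auto
  then show ?thesis
    using R r by (simp add: presented_class_def presented_group_def FactGroup_def
        F.coset_join2 N.subgroup_axioms subset_iff)
qed

lemma generate_presented_group:
  assumes "R \<subseteq> carrier free_group"
  shows "generate (presented_group R) (range (\<lambda>a. presented_class R (free_gen a)))
    = carrier (presented_group R)"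
proof -
  interpret group_hom free_group "presented_group R" "presented_class R"
    by (rule presented_class_hom[OF assms])
  have "presented_class R ` carrier free_group = carrier (presented_group R)"
    by (auto simp: presented_class_def presented_group_def FactGroup_def RCOSETS_def)
  then show ?thesis
    using generate_img[of "range free_gen"] by (simp add: generate_free_gen image_image image_subset_iff)
qed

text \<open>The kernel of \<open>h\<close> contains the relators and is closed under conjugation, so
  it contains their normal closure and \<open>h\<close> factors through the quotient.\<close>

lemma presented_group_universal:
  assumes R: "R \<subseteq> carrier free_group" and h: "group_hom free_group H h"
    and rel: "\<And>r. r \<in> R \<Longrightarrow> h r = \<one>\<^bsub>H\<^esub>"
  obtains g where "g \<in> hom (presented_group R) H"
    "\<And>w. w \<in> carrier free_group \<Longrightarrow> g (presented_class R w) = h w"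
proof -
  interpret h: group_hom free_group H h by (rule h)
  have "normal_closure free_group R \<subseteq> kernel free_group H h"
    unfolding normal_closure_def
  proof (rule h.G.generate_subgroup_incl[OF _ h.subgroup_kernel], clarify)
    fix r k assume "r \<in> R" "k \<in> carrier (free_group :: 'a letter list monoid)"
    then show "k \<otimes>\<^bsub>free_group\<^esub> r \<otimes>\<^bsub>free_group\<^esub> inv\<^bsub>free_group\<^esub> k \<in> kernel free_group H h"
      using R rel[of r] by (auto simp: kernel_def subset_iff)
  qed
  then show ?thesis
    using h.FactGroup_universal_kernel[OF h.G.normal_closure_normal[OF R]] that
    unfolding presented_class_def presented_group_def by metis
qed

section \<open>Geometric sums modulo prime powers\<close>

text \<open>Grouping the indices into \<open>j\<close> blocks of length \<open>k\<close> lets a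
  single factor \<open>p\<close> be split off the range of summation in the induction for
  \<open>cong_sum_power_prime_power\<close>.\<close>

lemma sum_power_mult_index:
  fixes r :: "'a :: comm_semiring_1"
  shows "(\<Sum>i<k * j. r ^ i) = (\<Sum>i<k. r ^ i) * (\<Sum>i<j. (r ^ k) ^ i)"
proof (induction j)
  case (Suc j)
  have "(\<Sum>i<m + k. r ^ i) = (\<Sum>i<m. r ^ i) + r ^ m * (\<Sum>i<k. r ^ i)" for m
    by (induction k) (simp_all add: algebra_simps power_add)
  from this[of "k * j"] show ?case
    using Suc by (simp add: algebra_simps flip: power_mult)
qed simp

lemma cong_sum_power:
  fixes r p :: nat
  assumes "[r = 1] (mod p)"
  shows "[(\<Sum>i<j. r ^ i) = j] (mod p)"
proof -
  have "[(\<Sum>i<j. r ^ i) = (\<Sum>i<j. 1)] (mod p)"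
    using cong_pow[OF assms] by (intro cong_sum) simp
  then show ?thesis by simp
qed

text \<open>With \<open>r = 1 + t * p\<close>, the binomial expansion gives
  \<open>r ^ i = 1 + i * t * p\<close> modulo \<open>p ^ 2\<close>. The sum is then \<open>p\<close>
  plus \<open>t * p\<close> times \<open>p * (p - 1) / 2\<close>, and for odd \<open>p\<close> this
  last quotient is a multiple of \<open>p\<close>.\<close>

lemma cong_sum_power_square:
  fixes r p :: nat
  assumes r: "[r = 1] (mod p)" and p: "odd p"
  shows "[(\<Sum>i<p. r ^ i) = p] (mod p ^ 2)"
\<comment> \<open>For \<open>p = 1\<close> the number \<open>r\<close> could be 0, which is not
  \<open>1 + t * p\<close> for any natural \<open>t\<close>.\<close>
proof (cases "p = 1")
  case False
  then obtain t where t: "r = 1 + t * p"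
    using r cong_to_1'_nat by blast
  have power: "[r ^ i = 1 + i * (t * p)] (mod p ^ 2)" for i
  proof (induction i)
    case (Suc i)
    have "[r * r ^ i = r * (1 + i * (t * p))] (mod p ^ 2)"
      using Suc by (rule cong_scalar_left)
    also have "r * (1 + i * (t * p)) = 1 + Suc i * (t * p) + (i * t * t) * p ^ 2"
      by (simp add: t algebra_simps power2_eq_square)
    also have "[\<dots> = 1 + Suc i * (t * p)] (mod p ^ 2)"
      by (simp add: cong_def)
    finally show ?case by simp
  qed simp
  have "2 * (\<Sum>i<p. i) = p * (p - 1)"
    using gauss_sum_nat[of "p - 1"] p
    by (cases p) (auto simp: lessThan_Suc_atMost atLeast0AtMost)
  then have "p dvd 2 * (\<Sum>i<p. i)" by simp
  then have "p dvd (\<Sum>i<p. i)"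
    using p by (simp add: coprime_dvd_mult_right_iff)
  then obtain s where s: "(\<Sum>i<p. i) = p * s" ..
  have "[(\<Sum>i<p. r ^ i) = (\<Sum>i<p. 1 + i * (t * p))] (mod p ^ 2)"
    by (intro cong_sum power)
  also have "(\<Sum>i<p. 1 + i * (t * p)) = p + (s * t) * p ^ 2"
    unfolding sum.distrib sum_distrib_right[symmetric] s
    by (simp add: algebra_simps power2_eq_square)
  also have "[\<dots> = p] (mod p ^ 2)"
    by (simp add: cong_def)
  finally show ?thesis .
qed auto

text \<open>Induction on \<open>k\<close>, passing from \<open>r\<close> to \<open>r ^ p\<close>.
  The sum factors into the first \<open>p\<close> powers of \<open>r\<close>, which add up to
  \<open>p * c\<close> with \<open>c = 1\<close> modulo \<open>p\<close>, and a shorter sum with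
  ratio \<open>r ^ p\<close> that the induction hypothesis covers.\<close>

lemma cong_sum_power_prime_power:
  fixes r p :: nat
  assumes "[r = 1] (mod p)" and p: "odd p"
  shows "[(\<Sum>i<p ^ k * j. r ^ i) = p ^ k * j] (mod p ^ Suc k)"
  using assms(1)
proof (induction k arbitrary: r)
  case 0
  then show ?case using cong_sum_power by simp
next
  case (Suc k)
  have p0: "p > 0" using p by (rule odd_pos)
  have sq: "[(\<Sum>i<p. r ^ i) = p] (mod p * p)"
    using cong_sum_power_square[OF Suc.prems p] by (simp add: power2_eq_square)
  then have "p dvd (\<Sum>i<p. r ^ i)"
    using cong_dvd_iff[OF cong_modulus_mult_nat[OF sq]] by simp
  then obtain c where c: "(\<Sum>i<p. r ^ i) = p * c" ..
  have c1: "[c = 1] (mod p)"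
    using sq p0 by (simp add: c cong_def flip: mult_mod_right)
  have "[r ^ p = 1] (mod p)"
    using cong_pow[OF Suc.prems, of p] by simp
  from Suc.IH[OF this]
  have "[p * (\<Sum>i<p ^ k * j. (r ^ p) ^ i) = p * (p ^ k * j)] (mod p * p ^ Suc k)"
    by (rule cong_cmult_leftI)
  then have "[c * (p * (\<Sum>i<p ^ k * j. (r ^ p) ^ i)) = c * (p * (p ^ k * j))] (mod p ^ Suc (Suc k))"
    unfolding power_Suc[of p "Suc k"] by (rule cong_scalar_left)
  also have "c * (p * (p ^ k * j)) = p ^ Suc k * c * j"
    by simp
  also have "[p ^ Suc k * c * j = p ^ Suc k * 1 * j] (mod p ^ Suc (Suc k))"
    using cong_scalar_right[OF cong_cmult_leftI[OF c1, of "p ^ Suc k"], of j]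
    by (simp add: mult.commute)
  finally show ?case
    using sum_power_mult_index[of r p "p ^ k * j"] by (simp add: c ac_simps)
qed

text \<open>In \<open>r ^ m - 1 = (r - 1) * (1 + r + ... + r ^ (m - 1))\<close> the first factor
  supplies one \<open>p\<close>, and for \<open>m = p ^ k * j\<close> the geometric sum supplies
  \<open>p ^ k\<close>.\<close>

lemma cong_power_prime_power:
  fixes r p :: nat
  assumes r: "[r = 1] (mod p)" and p: "odd p"
  shows "[r ^ (p ^ k * j) = 1] (mod p ^ Suc k)"
proof (cases "p = 1")
  case False
  then obtain t where t: "r = 1 + t * p"
    using r cong_to_1'_nat by blast
  have "r ^ m = 1 + t * p * (\<Sum>i<m. r ^ i)" for m
    by (induction m) (simp_all add: t algebra_simps)
  moreover have "p ^ k dvd (\<Sum>i<p ^ k * j. r ^ i)"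
    using cong_dvd_iff[OF cong_dvd_modulus_nat[OF cong_sum_power_prime_power[OF r p]]]
    by (metis dvd_triv_left dvd_triv_right power_Suc)
  ultimately obtain s where "r ^ (p ^ k * j) = 1 + t * p * (p ^ k * s)"
    unfolding dvd_def by metis
  then have "r ^ (p ^ k * j) = 1 + (t * s) * p ^ Suc k"
    by (simp add: ac_simps)
  then show ?thesis
    unfolding cong_to_1'_nat by blast
qed auto

section \<open>Metacyclic groups\<close>

lemma (in group) conj_by_eq_iff:
  assumes "a \<in> carrier G" "g \<in> carrier G" "b \<in> carrier G"
  shows "conj_by G a g = b \<longleftrightarrow> a \<otimes> g = g \<otimes> b"
  using assms by (simp add: conj_by_def m_assoc inv_solve_left')

text \<open>Only the relations and generation are assumed, so the locale applies to the presented
  group before its order is known.\<close>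

locale metacyclic = group G for G (structure) +
  fixes x y :: 'a and q r :: nat
  assumes x [simp]: "x \<in> carrier G" and y [simp]: "y \<in> carrier G"
    and x_pow: "x [^] q = \<one>" and y_pow: "y [^] q = \<one>"
    and conj_x_y: "conj_by G x y = x [^] r"
    and q_pos: "q > 0"
    and generate_xy: "generate G {x, y} = carrier G"
begin

text \<open>Placing the power of \<open>y\<close> first fits the relation
  \<open>x y = y x^r\<close>: powers of \<open>x\<close> move to the right past powers of
  \<open>y\<close>, and only natural powers of \<open>r\<close> occur.\<close>

definition elt :: "nat \<Rightarrow> nat \<Rightarrow> 'a" where
  "elt a b = y [^] a \<otimes> x [^] b"

lemma elt_closed [simp]: "elt a b \<in> carrier G"
  by (simp add: elt_def)

lemma x_pow_mult_y_pow: "x [^] (b :: nat) \<otimes> y [^] (c :: nat) = y [^] c \<otimes> x [^] (b * r ^ c)"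
proof (induction c arbitrary: b)
  case (Suc c)
  have xy: "x \<otimes> y = y \<otimes> x [^] r"
    using conj_x_y by (simp add: conj_by_eq_iff)
  have x1: "x [^] b \<otimes> y = y \<otimes> x [^] (b * r)" for b :: nat
  proof (induction b)
    case (Suc b)
    have "x [^] Suc b \<otimes> y = x [^] b \<otimes> y \<otimes> x [^] r"
      by (simp add: m_assoc xy)
    also have "\<dots> = y \<otimes> x [^] (Suc b * r)"
      by (simp add: Suc m_assoc nat_pow_mult add.commute)
    finally show ?case .
  qed simp
  have "x [^] b \<otimes> y [^] Suc c = y [^] c \<otimes> (x [^] (b * r ^ c) \<otimes> y)"
    using Suc[of b] by (simp flip: m_assoc)
  then show ?case
    by (simp add: x1 ac_simps flip: m_assoc)
qed simp

lemma elt_mult: "elt a b \<otimes> elt c d = elt (a + c) (b * r ^ c + d)"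
proof -
  have "elt a b \<otimes> elt c d = y [^] a \<otimes> (x [^] b \<otimes> y [^] c) \<otimes> x [^] d"
    by (simp add: elt_def m_assoc)
  also have "\<dots> = elt (a + c) (b * r ^ c + d)"
    unfolding x_pow_mult_y_pow by (simp add: elt_def m_assoc flip: nat_pow_mult)
  finally show ?thesis .
qed

lemma elt_0 [simp]: "elt 0 0 = \<one>"
  by (simp add: elt_def)

text \<open>Each further factor multiplies the accumulated exponent of \<open>x\<close> by
  \<open>r ^ a\<close> and adds \<open>b\<close>, which is the Horner scheme of a geometric
  sum.\<close>

lemma elt_pow: "elt a b [^] m = elt (a * m) (b * (\<Sum>i<m. (r ^ a) ^ i))"
proof (induction m)
  case (Suc m)
  have "(\<Sum>i<Suc m. (r ^ a) ^ i) = (\<Sum>i<m. (r ^ a) ^ i) * r ^ a + 1"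
    by (simp add: sum.lessThan_Suc_shift sum_distrib_left mult.commute del: sum.lessThan_Suc)
  then show ?case
    using Suc by (simp add: elt_mult algebra_simps)
qed simp

lemma elt_cong:
  assumes "[a = c] (mod q)" "[b = d] (mod q)"
  shows "elt a b = elt c d"
proof -
  have "z [^] m = z [^] (m mod q)" if "z \<in> carrier G" "z [^] q = \<one>" for z and m :: nat
  proof -
    have "z [^] (q * (m div q) + m mod q) = (z [^] q) [^] (m div q) \<otimes> z [^] (m mod q)"
      using that(1) by (simp only: nat_pow_pow nat_pow_mult)
    then show ?thesis using that by simp
  qed
  from this[OF x x_pow] this[OF y y_pow] show ?thesis
    using assms unfolding elt_def cong_def by metis
qed

text \<open>The normal forms are closed under products by \<open>elt_mult\<close>, and the inverses
  of the generators are their powers with exponent \<open>q - 1\<close>.\<close>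

lemma elt_surj:
  assumes "z \<in> carrier G"
  shows "\<exists>a b. z = elt a b"
proof -
  have x_eq: "x = elt 0 1" and y_eq: "y = elt 1 0"
    by (simp_all add: elt_def)
  have "inv x = elt 0 (q - 1)"
    using x_pow q_pos by (intro inv_equality) (auto simp: elt_def simp flip: nat_pow_Suc)
  moreover have "inv y = elt (q - 1) 0"
    using y_pow q_pos by (intro inv_equality) (auto simp: elt_def simp flip: nat_pow_Suc)
  moreover have "z \<in> generate G {x, y}"
    using assms generate_xy by simp
  then show ?thesis
  proof induction
    case one
    show ?case using elt_0 by metis
  next
    case (incl h)
    then show ?case using x_eq y_eq by blast
  next
    case (inv h)
    then show ?case using calculation by blast
  next
    case (eng h1 h2)
    then show ?case using elt_mult by metis
  qed
qed

lemma elt_image: "(\<lambda>(a, b). elt a b) ` ({..<q} \<times> {..<q}) = carrier G"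
proof
  show "carrier G \<subseteq> (\<lambda>(a, b). elt a b) ` ({..<q} \<times> {..<q})"
  proof
    fix z assume "z \<in> carrier G"
    then obtain a b where "z = elt a b" using elt_surj by blast
    also have "\<dots> = elt (a mod q) (b mod q)"
      by (rule elt_cong) simp_all
    finally show "z \<in> (\<lambda>(a, b). elt a b) ` ({..<q} \<times> {..<q})"
      using q_pos by (intro image_eqI[of _ _ "(a mod q, b mod q)"]) auto
  qed
qed auto

lemma finite_carrier: "finite (carrier G)"
  unfolding elt_image[symmetric] by simp

lemma order_le: "order G \<le> q * q"
  unfolding order_def elt_image[symmetric]
  using card_image_le[of "{..<q} \<times> {..<q}" "\<lambda>(a, b). elt a b"] by simp

text \<open>A surjection from the \<open>q * q\<close> pairs of reduced exponents onto a set of the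
  same size is injective.\<close>

lemma elt_eq_iff:
  assumes "order G = q * q"
  shows "elt a b = elt c d \<longleftrightarrow> [a = c] (mod q) \<and> [b = d] (mod q)"
proof
  have "inj_on (\<lambda>(a, b). elt a b) ({..<q} \<times> {..<q})"
    using assms by (intro eq_card_imp_inj_on) (simp_all add: elt_image order_def)
  moreover assume "elt a b = elt c d"
  then have "elt (a mod q) (b mod q) = elt (c mod q) (d mod q)"
    using elt_cong[of "a mod q" a "b mod q" b] elt_cong[of "c mod q" c "d mod q" d] by simp
  ultimately show "[a = c] (mod q) \<and> [b = d] (mod q)"
    using q_pos inj_onD[of "\<lambda>(a, b). elt a b" _ "(a mod q, b mod q)" "(c mod q, d mod q)"] by (auto simp: cong_def)
qed (auto intro: elt_cong)

end

section \<open>A semidirect product of two cyclic groups of order q\<close>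

definition metacyclic_model :: "nat \<Rightarrow> nat \<Rightarrow> (nat \<times> nat) monoid" where
  "metacyclic_model q r = \<lparr>carrier = {..<q} \<times> {..<q},
     monoid.mult = (\<lambda>(a, b) (c, d). ((a + c) mod q, (b * r ^ c + d) mod q)), one = (0, 0)\<rparr>"

text \<open>The multiplication copies \<open>elt_mult\<close>, with \<open>(a, b)\<close> in the
  role of \<open>y^a x^b\<close>. Since \<open>r ^ q = 1\<close> modulo \<open>q\<close>, the factor
  \<open>r ^ c\<close> depends only on \<open>c\<close> modulo \<open>q\<close>, which gives
  associativity.\<close>

lemma group_metacyclic_model:
  assumes q: "q > 0" and r: "[r ^ q = 1] (mod q)"
  shows "group (metacyclic_model q r)"
proof (rule groupI)
  have pow_mod: "[r ^ (a mod q) = r ^ a] (mod q)" for a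
  proof -
    have "[(r ^ q) ^ (a div q) * r ^ (a mod q) = 1 ^ (a div q) * r ^ (a mod q)] (mod q)"
      by (intro cong_mult cong_pow r) simp
    also have "(r ^ q) ^ (a div q) * r ^ (a mod q) = r ^ a"
      by (simp flip: power_mult power_add)
    finally show ?thesis by (simp add: cong_sym)
  qed
  fix u assume u: "u \<in> carrier (metacyclic_model q r)"
  then obtain a b where ab: "u = (a, b)" "a < q" "b < q"
    by (auto simp: metacyclic_model_def)
  {
    fix v w
    assume "v \<in> carrier (metacyclic_model q r)" "w \<in> carrier (metacyclic_model q r)"
    then obtain c d e f where cd: "v = (c, d)" and ef: "w = (e, f)"
      by (cases v; cases w) auto
    have "[((b * r ^ c + d) mod q) * r ^ e + f = (b * r ^ c + d) * r ^ e + f] (mod q)"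
      by (intro cong_add cong_mult) simp_all
    also have "(b * r ^ c + d) * r ^ e + f = b * r ^ (c + e) + (d * r ^ e + f)"
      by (simp add: algebra_simps power_add)
    also have "[\<dots> = b * r ^ ((c + e) mod q) + ((d * r ^ e + f) mod q)] (mod q)"
      using pow_mod by (intro cong_add cong_mult) (simp_all add: cong_sym)
    finally show "u \<otimes>\<^bsub>metacyclic_model q r\<^esub> v \<otimes>\<^bsub>metacyclic_model q r\<^esub> w
        = u \<otimes>\<^bsub>metacyclic_model q r\<^esub> (v \<otimes>\<^bsub>metacyclic_model q r\<^esub> w)"
      by (simp add: ab cd ef metacyclic_model_def cong_def mod_simps add.assoc)
  }
  \<comment> \<open>The inverse of \<open>y^a x^b\<close> is \<open>x^(-b) y^(-a)\<close>; moving
    \<open>y^(-a)\<close> to the front multiplies the exponent of \<open>x\<close> by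
    \<open>r^(-a)\<close>, represented here by \<open>r ^ (q - a)\<close>.\<close>
  let ?c = "(q - a) mod q" and ?d = "((q - b) * r ^ (q - a)) mod q"
  have "[?d * r ^ a + b = (q - b) * r ^ (q - a) * r ^ a + b] (mod q)"
    by (intro cong_add cong_mult) simp_all
  also have "(q - b) * r ^ (q - a) * r ^ a = (q - b) * r ^ q"
    using ab by (simp add: mult.assoc flip: power_add)
  also have "[(q - b) * r ^ q + b = (q - b) * 1 + b] (mod q)"
    by (intro cong_add cong_mult r) simp_all
  also have "(q - b) * 1 + b = q" using ab by simp
  finally have "(?d * r ^ a + b) mod q = 0"
    by (simp add: cong_def)
  moreover have "(?c + a) mod q = 0"
    using ab by (simp add: mod_simps)
  ultimately show "\<exists>v\<in>carrier (metacyclic_model q r).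
      v \<otimes>\<^bsub>metacyclic_model q r\<^esub> u = \<one>\<^bsub>metacyclic_model q r\<^esub>"
    using q by (intro bexI[of _ "(?c, ?d)"]) (simp_all add: metacyclic_model_def ab)
qed (use q in \<open>auto simp: metacyclic_model_def\<close>)

text \<open>The form \<open>1 mod q\<close> keeps both elements in the carrier also for
  \<open>q = 1\<close>.\<close>

lemma metacyclic_model_pow:
  assumes "q > 0"
  shows "(0, 1 mod q) [^]\<^bsub>metacyclic_model q r\<^esub> k = (0, k mod q)"
    and "(1 mod q, 0) [^]\<^bsub>metacyclic_model q r\<^esub> k = (k mod q, 0)"
  by (induction k; simp add: metacyclic_model_def nat_pow_def mod_simps)+

section \<open>The Beauville structure\<close>

lemma (in group) conj_by_pow:
  assumes "a \<in> carrier G" "g \<in> carrier G"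
  shows "conj_by G a g [^] (m :: nat) = conj_by G (a [^] m) g"
proof (induction m)
  case (Suc m)
  have "g \<otimes> (inv g \<otimes> z) = z" if "z \<in> carrier G" for z
    using assms that by (simp flip: m_assoc)
  then show ?case
    using assms Suc by (simp add: conj_by_def m_assoc)
qed (use assms in \<open>simp add: conj_by_def\<close>)

lemma (in group) conj_by_eq_one_iff:
  assumes "a \<in> carrier G" "g \<in> carrier G"
  shows "conj_by G a g = \<one> \<longleftrightarrow> a = \<one>"
  using assms by (simp add: conj_by_eq_iff)

section \<open>Orders and central powers for exponent p^n\<close>

locale metacyclic_prime_power = metacyclic G x y "p ^ n" "p + 1"
  for G (structure) and x y and p n :: nat +
  assumes prime_p: "Factorial_Ring.prime p" and p_ge_5: "p \<ge> 5" and n_pos: "n > 0"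
    and order_G: "order G = p ^ n * p ^ n"
begin

lemmas elt_eq = elt_eq_iff[OF order_G]

lemma odd_p: "odd p"
  using prime_p p_ge_5 prime_odd_nat by auto

lemma cong_generator_power: "[(p + 1) ^ a = 1] (mod p)"
proof -
  have "[p + 1 = 1] (mod p)"
    by (simp only: cong_add_rcancel_0_nat cong_0_iff dvd_refl)
  from cong_pow[OF this, of a] show ?thesis
    by (simp only: power_one)
qed

lemma exponent_eq: "p ^ (n - 1) * p = p ^ n"
  using n_pos by (rule power_minus_mult)

text \<open>The ratio \<open>(p + 1) ^ a\<close> is 1 modulo \<open>p\<close>, so the geometric sum
  of \<open>p ^ (n - 1) * k\<close> terms equals its number of terms modulo \<open>p ^ n\<close>.
  Such powers behave as in an abelian group.\<close>

lemma elt_pow_prime_power: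
  "elt a b [^] (p ^ (n - 1) * k) = elt (a * (p ^ (n - 1) * k)) (b * (p ^ (n - 1) * k))"
  unfolding elt_pow using cong_sum_power_prime_power[OF cong_generator_power[of a] odd_p, of "n - 1" k] n_pos
  by (intro elt_cong cong_scalar_left) simp_all

lemma elt_eq_one_iff: "elt a b = \<one> \<longleftrightarrow> p ^ n dvd a \<and> p ^ n dvd b"
  using elt_eq[of a b 0 0] by (simp add: cong_0_iff)

lemma elt_pow_exponent: "elt a b [^] (p ^ n) = \<one>"
  using elt_pow_prime_power[of a b p] n_pos
  by (simp add: elt_eq_one_iff flip: power_Suc2)

text \<open>The order of \<open>elt a b\<close> is a power of \<open>p\<close>. Were it smaller than
  \<open>p ^ n\<close>, the power with exponent \<open>p ^ (n - 1)\<close> would be trivial and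
  \<open>p\<close> would divide both \<open>a\<close> and \<open>b\<close>.\<close>

lemma dvd_exponent:
  assumes "elt a b [^] m = \<one>" and "\<not> (p dvd a \<and> p dvd b)"
  shows "p ^ n dvd m"
proof -
  have "ord (elt a b) dvd p ^ n"
    using elt_pow_exponent by (simp flip: pow_eq_id)
  then obtain k where k: "k \<le> n" "ord (elt a b) = p ^ k"
    using prime_p by (auto simp: divides_primepow_nat)
  have "k = n"
  proof (rule ccontr)
    assume "k \<noteq> n"
    then have "ord (elt a b) dvd p ^ (n - 1) * 1"
      using k by (simp add: le_imp_power_dvd)
    then have "elt (a * (p ^ (n - 1) * 1)) (b * (p ^ (n - 1) * 1)) = \<one>"
      by (metis elt_pow_prime_power pow_eq_id elt_closed)
    then have "p * p ^ (n - 1) dvd a * p ^ (n - 1)" "p * p ^ (n - 1) dvd b * p ^ (n - 1)"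
      using n_pos by (simp_all add: elt_eq_one_iff flip: power_Suc)
    then show False
      using assms(2) prime_gt_0_nat[OF prime_p] by simp
  qed
  then show ?thesis
    using assms(1) k by (simp add: pow_eq_id)
qed

text \<open>In the commutation with \<open>elt c d\<close>, the factor \<open>(p + 1) ^ c\<close>
  fixes \<open>b\<close> modulo \<open>p ^ n\<close> because \<open>p ^ (n - 1)\<close> divides
  \<open>b\<close>, and \<open>(p + 1) ^ a\<close> is 1 modulo \<open>p ^ n\<close> because
  \<open>p ^ (n - 1)\<close> divides \<open>a\<close>.\<close>

lemma conj_by_elt_prime_power:
  assumes "p ^ (n - 1) dvd a" "p ^ (n - 1) dvd b" "g \<in> carrier G"
  shows "conj_by G (elt a b) g = elt a b"
proof -
  obtain c d where g: "g = elt c d"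
    using elt_surj assms(3) by blast
  obtain a' b' where ab: "a = p ^ (n - 1) * a'" "b = p ^ (n - 1) * b'"
    using assms by (auto elim!: dvdE)
  have "[p ^ (n - 1) * (p + 1) ^ c = p ^ (n - 1) * 1] (mod p ^ (n - 1) * p)"
    by (rule cong_cmult_leftI[OF cong_generator_power])
  then have b: "[b * (p + 1) ^ c = b] (mod p ^ n)"
    using cong_scalar_right[of "p ^ (n - 1) * (p + 1) ^ c" "p ^ (n - 1)" "p ^ n" b']
    unfolding exponent_eq ab by (simp add: ac_simps)
  have "[(p + 1) ^ a = 1] (mod p ^ n)"
    using cong_power_prime_power[OF cong_generator_power[of 1] odd_p, of "n - 1" a'] n_pos
    by (simp add: ab)
  then have "[d * (p + 1) ^ a = d * 1] (mod p ^ n)"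
    by (rule cong_scalar_left)
  with b have "[b * (p + 1) ^ c + d = d * (p + 1) ^ a + b] (mod p ^ n)"
    by (metis add.commute cong_add cong_sym mult_1_right)
  then have "elt a b \<otimes> g = g \<otimes> elt a b"
    unfolding g elt_mult by (intro elt_cong) (simp_all add: add.commute)
  then show ?thesis
    using assms(3) by (simp add: conj_by_eq_iff)
qed

text \<open>The subgroup of order \<open>p\<close> in the cyclic group generated by \<open>elt a b\<close> is central and
  generated by \<open>elt (a * p ^ (n - 1)) (b * p ^ (n - 1))\<close>, so it only depends on the point
  \<open>(a : b)\<close> of the projective line over the field with \<open>p\<close> elements.\<close>

lemma conj_powers_disjoint:
  assumes indep: "\<not> [a * d = b * c] (mod p)"
    and g: "g \<in> carrier G" and h: "h \<in> carrier G"
    and eq: "conj_by G (elt a b [^] (i :: nat)) g = conj_by G (elt c d [^] (j :: nat)) h"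
  shows "conj_by G (elt a b [^] i) g = \<one>"
proof (rule ccontr)
  define z where "z = conj_by G (elt a b [^] i) g"
  assume "conj_by G (elt a b [^] i) g \<noteq> \<one>"
  then have "z [^] (p ^ 0) \<noteq> \<one>"
    using g by (simp add: z_def conj_by_def)
  moreover have z_pow: "z [^] m = conj_by G (elt a b [^] (i * m)) g"
      "z [^] m = conj_by G (elt c d [^] (j * m)) h" for m :: nat
    using g h by (simp add: z_def conj_by_pow nat_pow_pow, simp add: z_def eq conj_by_pow nat_pow_pow)
  have "z [^] (p ^ n) = \<one>"
    using g elt_pow_exponent[of a b]
    by (simp add: z_pow(1) conj_by_eq_one_iff mult.commute[of i] flip: nat_pow_pow)
  \<comment> \<open>Taking \<open>p\<close>-th powers of \<open>z\<close> repeatedly reaches the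
    identity after at most \<open>n\<close> rounds; \<open>e\<close> marks a last nontrivial stage,
    so \<open>z [^] (p ^ e)\<close> has order \<open>p\<close>.\<close>
  ultimately obtain e where e: "z [^] (p ^ e) \<noteq> \<one>" "z [^] (p ^ Suc e) = \<one>"
    using dec_induct[of 0 n "\<lambda>e. z [^] (p ^ e) \<noteq> \<one>"] by blast
  have p0: "p > 0" using prime_p by (rule prime_gt_0_nat)
  \<comment> \<open>Applied to \<open>i\<close> and to \<open>j\<close>, this makes
    \<open>z [^] (p ^ e)\<close> a conjugate of a power with exponent divisible by
    \<open>p ^ (n - 1)\<close>. Such powers are central, so both conjugations drop out.\<close>
  have exponent: "\<exists>k. l * p ^ e = p ^ (n - 1) * k"
    if "u \<in> carrier G" "conj_by G (elt a' b' [^] (l * p ^ Suc e)) u = \<one>"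
      "\<not> (p dvd a' \<and> p dvd b')" for l u a' b'
  proof -
    have "p ^ n dvd l * p ^ Suc e"
      using that by (intro dvd_exponent[of a' b']) (simp_all add: conj_by_eq_one_iff)
    moreover have "p ^ n = p * p ^ (n - 1)"
      using n_pos by (simp flip: power_Suc)
    ultimately have "p * p ^ (n - 1) dvd p * (l * p ^ e)"
      by (simp add: ac_simps)
    then show ?thesis
      using p0 by (simp add: dvd_def)
  qed
  have ab: "\<not> (p dvd a \<and> p dvd b)" and cd: "\<not> (p dvd c \<and> p dvd d)"
    using indep by (auto simp: cong_def mod_eq_0_iff_dvd)
  obtain k l where k: "i * p ^ e = p ^ (n - 1) * k" and l: "j * p ^ e = p ^ (n - 1) * l"
    using exponent[OF g _ ab] exponent[OF h _ cd] e(2) z_pow by metis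
  have zk: "z [^] (p ^ e) = elt (a * (p ^ (n - 1) * k)) (b * (p ^ (n - 1) * k))"
    unfolding z_pow(1) k elt_pow_prime_power using g by (simp add: conj_by_elt_prime_power)
  have zl: "z [^] (p ^ e) = elt (c * (p ^ (n - 1) * l)) (d * (p ^ (n - 1) * l))"
    unfolding z_pow(2) l elt_pow_prime_power using h by (simp add: conj_by_elt_prime_power)
  have scale: "[p ^ (n - 1) * s = p ^ (n - 1) * t] (mod p ^ n) \<longleftrightarrow> [s = t] (mod p)" for s t
    using n_pos p0 by (cases n) (simp_all add: cong_def mult.commute[of p] flip: mult_mod_right)
  have "[p ^ (n - 1) * (a * k) = p ^ (n - 1) * (c * l)] (mod p ^ n)"
    "[p ^ (n - 1) * (b * k) = p ^ (n - 1) * (d * l)] (mod p ^ n)"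
    using zk unfolding zl elt_eq by (simp_all add: cong_sym_eq ac_simps)
  then have akcl: "[a * k = c * l] (mod p)" and bkdl: "[b * k = d * l] (mod p)"
    unfolding scale by auto
  \<comment> \<open>Otherwise the element \<open>z [^] (p ^ e)\<close> of order \<open>p\<close>
    would be trivial.\<close>
  have "\<not> p dvd k" "\<not> p dvd l"
  proof -
    have "elt (f * (p ^ (n - 1) * m)) (f' * (p ^ (n - 1) * m)) = \<one>" if "p dvd m" for m f f'
      using scale[of m 0] that by (simp add: elt_eq_one_iff cong_0_iff)
    then show "\<not> p dvd k" "\<not> p dvd l"
      using e(1) zk zl by metis+
  qed
  then have "coprime (k * l) p"
    using prime_p by (metis coprime_commute prime_dvd_mult_iff prime_imp_coprime)
  \<comment> \<open>Modulo \<open>p\<close> the vectors \<open>k (a, b)\<close> and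
    \<open>l (c, d)\<close> agree; cross-multiplying shows that \<open>k * l\<close> times the
    determinant vanishes.\<close>
  moreover have "[(a * k) * (d * l) = (c * l) * (b * k)] (mod p)"
    by (rule cong_mult[OF akcl cong_sym[OF bkdl]])
  then have "[(a * d) * (k * l) = (b * c) * (k * l)] (mod p)"
    by (simp add: ac_simps)
  ultimately show False
    using indep by (simp add: cong_mult_rcancel_nat)
qed

text \<open>This reduces the Beauville condition to nine determinants modulo \<open>p\<close>, one
  for each choice of a member from either triple of two generators and their product.\<close>

lemma Sigma_set_inter:
  assumes dirs: "u = elt a b" "v = elt a' b'" "u \<otimes> v = elt a'' b''"
      "s = elt c d" "t = elt c' d'" "s \<otimes> t = elt c'' d''"
    and indep: "\<And>e f. (e, f) \<in> {(a, b), (a', b'), (a'', b'')} \<times> {(c, d), (c', d'), (c'', d'')}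
      \<Longrightarrow> \<not> [fst e * snd f = snd e * fst f] (mod p)"
  shows "Sigma_set G u v \<inter> Sigma_set G s t = {\<one>}"
proof -
  have "\<one> \<in> Sigma_set G w w'" if "w \<in> carrier G" for w w'
  proof -
    have "order G \<in> {1..order G}" "conj_by G (w [^] order G) \<one> = \<one>"
      using that finite_carrier order_gt_0_iff_finite
      by (auto simp: pow_order_eq_1 conj_by_def Suc_le_eq)
    then show ?thesis
      unfolding Sigma_set_def by force
  qed
  moreover have "z = \<one>" if z: "z \<in> Sigma_set G u v" "z \<in> Sigma_set G s t" for z
  proof -
    have conj: "\<exists>w i g. w \<in> {w1, w2, w1 \<otimes> w2} \<and> g \<in> carrier G \<and> z = conj_by G (w [^] (i :: nat)) g"
      if "z \<in> Sigma_set G w1 w2" for w1 w2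
      using that unfolding Sigma_set_def by blast
    obtain w i g where w: "w \<in> {u, v, u \<otimes> v}" "g \<in> carrier G" "z = conj_by G (w [^] (i :: nat)) g"
      using conj[OF z(1)] by blast
    from w(1) obtain e where e: "e \<in> {(a, b), (a', b'), (a'', b'')}" "w = elt (fst e) (snd e)"
      \<comment> \<open>The product is rewritten first, since \<open>dirs(3)\<close> no longer
        matches once \<open>u\<close> and \<open>v\<close> are expanded.\<close>
      unfolding dirs(3) unfolding dirs(1,2) by fastforce
    obtain w' j h where w': "w' \<in> {s, t, s \<otimes> t}" "h \<in> carrier G" "z = conj_by G (w' [^] (j :: nat)) h"
      using conj[OF z(2)] by blast
    from w'(1) obtain f where f: "f \<in> {(c, d), (c', d'), (c'', d'')}" "w' = elt (fst f) (snd f)"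
      unfolding dirs(6) unfolding dirs(4,5) by fastforce
    have "\<not> [fst e * snd f = snd e * fst f] (mod p)"
      by (rule indep) (use e(1) f(1) in blast)
    from conj_powers_disjoint[OF this w(2) w'(2)] w(3) w'(3) show ?thesis
      unfolding e(2) f(2) by metis
  qed
  ultimately show ?thesis
    using dirs by auto
qed

text \<open>The two elements differ by \<open>x^(p-3)\<close>. As \<open>p\<close> is at least 5,
  \<open>p - 3\<close> is invertible modulo \<open>p ^ n\<close>, so \<open>x\<close> lies in the
  subgroup, and then so does \<open>y\<close>.\<close>

lemma generate_elt_pair: "generate G {elt 1 2, elt 1 (p - 1)} = carrier G"
proof
  let ?K = "generate G {elt 1 2, elt 1 (p - 1)}"
  have sub: "subgroup ?K G"
    by (rule generate_is_subgroup) simp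
  then interpret K: subgroup ?K G .
  have gens: "elt 1 2 \<in> ?K" "elt 1 (p - 1) \<in> ?K"
    by (auto intro: generate.incl)
  have K_pow: "z [^] (m :: nat) \<in> ?K" if "z \<in> ?K" for z m
    using that by (induction m) (simp_all only: nat_pow_0 nat_pow_Suc K.one_closed K.m_closed)
  have "inv (elt 1 2) \<otimes> elt 1 (p - 1) = x [^] (p - 3)"
  proof -
    have "x [^] (p - 3) = elt 0 (p - 3)"
      by (simp add: elt_def)
    moreover have "p - 1 = 2 + (p - 3)"
      using p_ge_5 by simp
    ultimately have "elt 1 (p - 1) = elt 1 2 \<otimes> x [^] (p - 3)"
      by (simp add: elt_mult)
    then show ?thesis by (simp add: inv_solve_left')
  qed
  then have x3: "x [^] (p - 3) \<in> ?K"
    using gens by (metis K.m_closed K.m_inv_closed)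
  have "\<not> p dvd p - 3"
    using p_ge_5 by (auto dest: dvd_imp_le)
  then have "coprime (p - 3) (p ^ n)"
    using prime_p by (simp add: prime_imp_coprime coprime_commute)
  then obtain m where "[(p - 3) * m = 1] (mod p ^ n)"
    using cong_solve_coprime_nat unfolding One_nat_def by blast
  then have "x = x [^] ((p - 3) * m)"
    using elt_cong[of 0 0 "(p - 3) * m" 1] by (simp add: elt_def)
  then have x_in: "x \<in> ?K"
    using K_pow[OF x3, of m] by (simp add: nat_pow_pow)
  have "elt 1 2 \<otimes> inv (x [^] (2 :: nat)) = y"
    by (simp add: elt_def m_assoc)
  then have y_in: "y \<in> ?K"
    using gens K_pow[OF x_in] by (metis K.m_closed K.m_inv_closed)
  show "carrier G \<subseteq> ?K"
    using generate_subgroup_incl[OF _ sub, of "{x, y}"] x_in y_in generate_xy by simp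
qed (simp add: generate_incl)

lemma beauville: "beauville_group G"
proof -
  \<comment> \<open>Here \<open>i\<close> is the determinant up to the multiple \<open>k\<close> of
    \<open>p\<close>; its absolute value is at most 2, hence less than \<open>p\<close>.\<close>
  have not_cong: "\<not> [e = f] (mod p)" if "int e - int f = i + k * int p" "i \<in> {1, 2, -1, -2}"
    for e f i k
  proof
    assume "[e = f] (mod p)"
    then have "int p dvd int e - int f"
      by (simp add: cong_iff_dvd_diff flip: cong_int_iff)
    then have "int p dvd i"
      using that(1) by simp
    then show False
      using that(2) p_ge_5 zdvd_imp_le[of "int p" i] zdvd_imp_le[of "int p" "- i"] by auto
  qed
  have indep: "\<not> [0 * 2 = 1 * 1] (mod p)" "\<not> [0 * (p - 1) = 1 * 1] (mod p)"
    "\<not> [0 * (3 * p + 1) = 1 * 2] (mod p)" "\<not> [1 * 2 = 0 * 1] (mod p)"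
    "\<not> [1 * (p - 1) = 0 * 1] (mod p)" "\<not> [1 * (3 * p + 1) = 0 * 2] (mod p)"
    "\<not> [1 * 2 = (p + 1) * 1] (mod p)" "\<not> [1 * (p - 1) = (p + 1) * 1] (mod p)"
    "\<not> [1 * (3 * p + 1) = (p + 1) * 2] (mod p)"
    using p_ge_5 not_cong[of _ _ "-1" 0] not_cong[of _ _ "-2" 0] not_cong[of _ _ 2 0]
      not_cong[of _ _ "-1" 1] not_cong[of _ _ 1 3] not_cong[of _ _ 1 "-1"]
    by (simp_all add: of_nat_diff)
  have "Sigma_set G x y \<inter> Sigma_set G (elt 1 2) (elt 1 (p - 1)) = {\<one>}"
  proof (rule Sigma_set_inter)
    show "x = elt 0 1" "y = elt 1 0" by (simp_all add: elt_def)
    show "x \<otimes> y = elt 1 (p + 1)"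
      using x_pow_mult_y_pow[of 1 1] by (simp add: elt_def)
    \<comment> \<open>The exponent of \<open>x\<close> is \<open>2 * (p + 1) + (p - 1)\<close>, so
      the product represents the point (2:1).\<close>
    show "elt 1 2 \<otimes> elt 1 (p - 1) = elt 2 (3 * p + 1)"
      using p_ge_5 by (simp add: elt_mult flip: numeral_2_eq_2)
  next
    fix e f :: "nat \<times> nat"
    assume "(e, f) \<in> {(0, 1), (1, 0), (1, p + 1)} \<times> {(1, 2), (1, p - 1), (2, 3 * p + 1)}"
    then show "\<not> [fst e * snd f = snd e * fst f] (mod p)"
      using indep by auto
  qed simp_all
  then have "beauville_structure G (x, y) (elt 1 2, elt 1 (p - 1))"
    using generate_xy generate_elt_pair by (simp add: beauville_structure_def)
  then show ?thesis
    using finite_carrier is_group by (auto simp: beauville_group_def)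
qed

text \<open>If \<open>x\<close> and \<open>y\<close> commuted, uniqueness of normal forms would make
  \<open>p ^ n\<close> divide \<open>p\<close>.\<close>

lemma not_comm:
  assumes "n \<ge> 2"
  shows "\<not> comm_group G"
proof
  assume "comm_group G"
  then have "elt 0 1 \<otimes> elt 1 0 = elt 1 0 \<otimes> elt 0 1"
    by (simp add: comm_groupE(4))
  then have "[p + 1 = 1] (mod p ^ n)"
    by (simp add: elt_mult elt_eq)
  then have "p ^ n dvd p ^ 1"
    using cong_add_rcancel_0_nat[of p 1 "p ^ n"] by (simp add: cong_0_iff)
  then show False
    using assms p_ge_5 power_dvd_imp_le[of p n 1] by simp
qed

end

section \<open>The order of the presented group and the conclusion\<close>

theorem lemma11:
  fixes p n :: nat
  assumes "Factorial_Ring.prime p" and "p \<ge> 5" and "n \<ge> 2"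
  shows "\<not> comm_group (metacyclic_group p n)
    \<and> beauville_group (metacyclic_group p n)
    \<and> order (metacyclic_group p n) = p ^ (2 * n)"
proof -
  let ?R = "metacyclic_relators p n" and ?G = "metacyclic_group p n"
    and ?M = "metacyclic_model (p ^ n) (p + 1)"
  let ?gx = "free_gen Gen_x" and ?gy = "free_gen Gen_y"
  let ?X = "presented_class ?R ?gx" and ?Y = "presented_class ?R ?gy"
  have q1: "p ^ n > 1"
    using assms by (intro one_less_power) auto
  then have p0: "p ^ n > 0" and one_mod: "1 mod p ^ n = 1"
    by linarith (use q1 in \<open>rule mod_less\<close>)
  have "odd p"
    using assms prime_odd_nat by auto
  have "[p + 1 = 1] (mod p)"
    by (simp only: cong_add_rcancel_0_nat cong_0_iff dvd_refl)
  \<comment> \<open>The instance holds modulo \<open>p ^ Suc n\<close> and is weakened to modulus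
    \<open>p ^ n\<close>.\<close>
  from cong_power_prime_power[OF this \<open>odd p\<close>, of n 1]
  have r: "[(p + 1) ^ p ^ n = 1] (mod p ^ n)"
    using cong_dvd_modulus_nat[of _ _ "p ^ Suc n" "p ^ n"] by simp
  interpret M: group ?M
    by (rule group_metacyclic_model[OF p0 r])
  interpret c: group_hom free_group ?G "presented_class ?R"
    unfolding metacyclic_group_def by (rule presented_class_hom[OF metacyclic_relators_in_carrier])
  have relators: "presented_class ?R w = \<one>\<^bsub>?G\<^esub>" if "w \<in> ?R" for w
    unfolding metacyclic_group_def
    by (rule presented_class_relator[OF metacyclic_relators_in_carrier that])
  interpret metacyclic ?G ?X ?Y "p ^ n" "p + 1"
  proof
    show "?X \<in> carrier ?G" "?Y \<in> carrier ?G" by simp_all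
    show "?X [^]\<^bsub>?G\<^esub> (p ^ n) = \<one>\<^bsub>?G\<^esub>" "?Y [^]\<^bsub>?G\<^esub> (p ^ n) = \<one>\<^bsub>?G\<^esub>"
      using relators[of "?gx [^]\<^bsub>free_group\<^esub> (p ^ n)"] relators[of "?gy [^]\<^bsub>free_group\<^esub> (p ^ n)"]
      unfolding c.hom_nat_pow[OF free_gen_in_carrier] by (simp_all add: metacyclic_relators_def Let_def)
    have "presented_class ?R (conj_by free_group ?gx ?gy \<otimes>\<^bsub>free_group\<^esub>
        inv\<^bsub>free_group\<^esub> (?gx [^]\<^bsub>free_group\<^esub> (p + 1))) = \<one>\<^bsub>?G\<^esub>"
      by (rule relators) (simp add: metacyclic_relators_def Let_def)
    then have "conj_by ?G ?X ?Y \<otimes>\<^bsub>?G\<^esub> inv\<^bsub>?G\<^esub> (?X [^]\<^bsub>?G\<^esub> (p + 1)) = \<one>\<^bsub>?G\<^esub>"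
      by (simp add: conj_by_def c.hom_nat_pow)
    then show "conj_by ?G ?X ?Y = ?X [^]\<^bsub>?G\<^esub> (p + 1)"
      by (simp add: conj_by_def c.H.inv_solve_right')
    show "p ^ n > 0" by (rule p0)
    have UNIV_generator: "(UNIV :: generator set) = {Gen_x, Gen_y}"
      using generator.exhaust by blast
    have "range (\<lambda>a. presented_class ?R (free_gen a)) = {?X, ?Y}"
      unfolding UNIV_generator by (simp only: image_insert image_empty)
    then show "generate ?G {?X, ?Y} = carrier ?G"
      using generate_presented_group[OF metacyclic_relators_in_carrier[of p n]]
      by (simp add: metacyclic_group_def)
  qed
  \<comment> \<open>The first coordinate of the model is the exponent of \<open>y\<close>, so
    \<open>x\<close> goes to (0, 1) and \<open>y\<close> to (1, 0).\<close>
  define f where "f = case_generator (0, 1 mod p ^ n) (1 mod p ^ n, 0 :: nat)"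
  have f_closed: "f a \<in> carrier ?M" for a
    using q1 p0 by (cases a) (simp_all add: f_def metacyclic_model_def one_mod del: One_nat_def)
  obtain h where h: "h \<in> hom free_group ?M" "\<And>a. h (free_gen a) = f a"
    using free_group_universal[of ?M f] M.group_axioms f_closed by blast
  interpret h: group_hom free_group ?M h
    using h(1) group_free_group by unfold_locales
  have hx: "h ?gx = (0, 1 mod p ^ n)" and hy: "h ?gy = (1 mod p ^ n, 0)"
    by (simp_all add: h(2) f_def)
  have h_rel: "h w = \<one>\<^bsub>?M\<^esub>" if "w \<in> ?R" for w
  proof -
    have "h ?gx \<otimes>\<^bsub>?M\<^esub> h ?gy = h ?gy \<otimes>\<^bsub>?M\<^esub> (h ?gx [^]\<^bsub>?M\<^esub> (p + 1))"
      unfolding hx hy metacyclic_model_pow[OF p0] by (simp add: metacyclic_model_def mod_simps one_mod)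
    then have "conj_by ?M (h ?gx) (h ?gy) = h ?gx [^]\<^bsub>?M\<^esub> (p + 1)"
      by (subst M.conj_by_eq_iff) (simp_all only: h.hom_closed free_gen_in_carrier M.nat_pow_closed)
    then have "h (conj_by free_group ?gx ?gy \<otimes>\<^bsub>free_group\<^esub>
        inv\<^bsub>free_group\<^esub> (?gx [^]\<^bsub>free_group\<^esub> (p + 1))) = \<one>\<^bsub>?M\<^esub>"
      by (simp only: conj_by_def h.hom_mult h.hom_inv h.hom_nat_pow free_gen_in_carrier h.hom_closed
          c.G.m_closed c.G.inv_closed c.G.nat_pow_closed M.nat_pow_closed M.r_inv)
    moreover have "h (?gx [^]\<^bsub>free_group\<^esub> (p ^ n)) = \<one>\<^bsub>?M\<^esub>"
        "h (?gy [^]\<^bsub>free_group\<^esub> (p ^ n)) = \<one>\<^bsub>?M\<^esub>"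
      by (simp_all only: h.hom_nat_pow free_gen_in_carrier hx hy metacyclic_model_pow[OF p0])
        (simp_all add: metacyclic_model_def)
    ultimately show ?thesis
      using that by (auto simp only: metacyclic_relators_def Let_def insert_iff empty_iff)
  qed
  obtain g where g: "g \<in> hom ?G ?M" "\<And>w. w \<in> carrier free_group \<Longrightarrow> g (presented_class ?R w) = h w"
    using presented_group_universal[OF metacyclic_relators_in_carrier h.group_hom_axioms h_rel]
    unfolding metacyclic_group_def by blast
  interpret g: group_hom ?G ?M g
    using g(1) by unfold_locales
  \<comment> \<open>This makes \<open>g\<close> surjective, which bounds the order from below;
    \<open>order_le\<close> gives the matching upper bound.\<close>
  have "g (elt a b) = (a mod p ^ n, b mod p ^ n)" for a b
    unfolding elt_def
    by (simp only: g.hom_mult g.hom_nat_pow c.hom_closed free_gen_in_carrier c.H.nat_pow_closed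
        g(2) hx hy metacyclic_model_pow[OF p0])
      (simp add: metacyclic_model_def)
  then have "(a, b) \<in> g ` carrier ?G" if "a < p ^ n" "b < p ^ n" for a b
    using that by (intro image_eqI[of _ _ "elt a b"]) (simp_all only: mod_less elt_closed)
  then have "carrier ?M \<subseteq> g ` carrier ?G"
    by (auto simp: metacyclic_model_def)
  then have "card (carrier ?M) \<le> order ?G"
    unfolding order_def using finite_carrier by (rule surj_card_le[rotated])
  then have order: "order ?G = p ^ n * p ^ n"
    using order_le by (simp add: metacyclic_model_def)
  interpret metacyclic_prime_power ?G ?X ?Y p n
    by unfold_locales (use assms order in auto)
  show ?thesis
    using not_comm beauville order assms(3) by (simp add: mult_2 power_add)
qed

end
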